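(* Let $\Sigma,\Lambda\in\mathrm{Cov}(n)$ with $\mathrm{rk}(\Sigma)=k$ and $\mathrm{rk}(\Lambda)=l$. Let $X,Y\in\mathbb{R}^{n\times n}$ be such that $XX^\top=\Sigma$ and $YY^\top=\Lambda$. The two following statements are equivalent: (i) the curve $\gamma:[0,1]\to\mathrm{Cov}(n)$ is a minimizing geodesic segment from $\Sigma$ to $\Lambda$ for the Bures-Wasserstein distance; (ii) there exists $R\in\mathrm{O}(n)$ such that $H_{X,Y,R}:=X^\top YR^\top\in\mathrm{Cov}(n)$ and, for all $t\in[0,1]$, $$\gamma(t)=\gamma^R_{\Sigma\to\Lambda}(t)=(1-t)^2\Sigma+t^2\Lambda+2t(1-t)\,\mathrm{sym}(XRY^\top).$$ Moreover, $H_{X,Y,R}=(X^\top\Lambda X)^{1/2}$ and the minimizing geodesic $\gamma^R_{\Sigma\to\Lambda}$ is of constant rank $p\ge\max(k,l)$ on $(0,1)$.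
   Context: $\mathrm{Cov}(n)$ is the set of real symmetric positive semi-definite $n\times n$ matrices; $\mathrm{O}(n)$ is the orthogonal group; $\mathrm{sym}(M)=\frac12(M+M^\top)$; $A^{1/2}$ is the unique symmetric positive semi-definite square root of a symmetric positive semi-definite $A$. The Bures-Wasserstein distance on $\mathrm{Cov}(n)$ is $d^{\mathrm{BW}}(\Sigma,\Lambda)=\inf\{\|X-Y\|_2: X,Y\in\mathbb{R}^{n\times n},\ XX^\top=\Sigma,\ YY^\top=\Lambda\}=\mathrm{tr}(\Sigma+\Lambda-2(\Sigma^{1/2}\Lambda\Sigma^{1/2})^{1/2})^{1/2}$, where $\|M\|_2=\mathrm{tr}(M^\top M)^{1/2}$. In a metric space $(\mathcal{M},d)$, the length of a continuous curve $c:[a,b]\to\mathcal{M}$ is $L(c)=\sup\sum_i d(c(t_i),c(t_{i+1}))$ over subdivisions of $[a,b]$. A curve $c:I\to\mathcal{M}$ is minimizing if $L(c|_{[a,b]})=d(c(a),c(b))$ for all $a\le b$ in $I$; it has constant speed if there is $v\ge0$ with $L(c|_{[t,t']})=v(t'-t)$ for all $t\le t'$ in $I$; a minimizing geodesic is a minimizing curve of constant speed (a segment when $I$ is a compact interval). *)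

theory Defs
  imports "HOL-Analysis.Analysis"
begin

section \<open>Curves in a metric space\<close>

context Metric_space
begin

text \<open>The supremum is taken in the extended reals, since the length may be infinite.\<close>

definition curve_length :: "(real \<Rightarrow> 'a) \<Rightarrow> real \<Rightarrow> real \<Rightarrow> ereal" where
  "curve_length c a b =
     (SUP (N, t) \<in> {(N :: nat, t :: nat \<Rightarrow> real).
                     t 0 = a \<and> t N = b \<and> (\<forall>i<N. t i \<le> t (Suc i))}.
        ereal (\<Sum>i<N. d (c (t i)) (c (t (Suc i)))))"

text \<open>Only the values of \<open>c\<close> on \<open>I\<close> matter; \<open>continuous_map\<close> includes that they lie in \<open>M\<close>.\<close>

definition curve_on :: "real set \<Rightarrow> (real \<Rightarrow> 'a) \<Rightarrow> bool" where
  "curve_on I c \<longleftrightarrow> is_interval I \<and> continuous_map (top_of_set I) mtopology c"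

definition minimizing_on :: "real set \<Rightarrow> (real \<Rightarrow> 'a) \<Rightarrow> bool" where
  "minimizing_on I c \<longleftrightarrow>
     (\<forall>a\<in>I. \<forall>b\<in>I. a \<le> b \<longrightarrow> curve_length c a b = ereal (d (c a) (c b)))"

definition constant_speed_on :: "real set \<Rightarrow> (real \<Rightarrow> 'a) \<Rightarrow> bool" where
  "constant_speed_on I c \<longleftrightarrow>
     (\<exists>v\<ge>0. \<forall>t\<in>I. \<forall>t'\<in>I. t \<le> t' \<longrightarrow> curve_length c t t' = ereal (v * (t' - t)))"

definition minimizing_geodesic_on :: "real set \<Rightarrow> (real \<Rightarrow> 'a) \<Rightarrow> bool" where
  "minimizing_geodesic_on I c \<longleftrightarrow>
     curve_on I c \<and> minimizing_on I c \<and> constant_speed_on I c"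

end

section \<open>Covariance matrices\<close>

definition Cov :: "(real^'n^'n) set" where
  "Cov = {A. transpose A = A \<and> (\<forall>x. 0 \<le> x \<bullet> (A *v x))}"

definition sym_part :: "real^'n^'n \<Rightarrow> real^'n^'n" where
  "sym_part M = (1/2) *\<^sub>R (M + transpose M)"

definition cov_sqrt :: "real^'n^'n \<Rightarrow> real^'n^'n" where
  "cov_sqrt A = (THE B. B \<in> Cov \<and> B ** B = A)"

definition frob_norm :: "real^'n^'n \<Rightarrow> real" where
  "frob_norm M = sqrt (trace (transpose M ** M))"

text \<open>The value \<open>0\<close> outside \<open>Cov\<close> is a dummy: the locale \<open>Metric_space\<close> requires its distance
  to be nonnegative and symmetric on the whole type.\<close>

definition bw_dist :: "real^'n^'n \<Rightarrow> real^'n^'n \<Rightarrow> real" where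
  "bw_dist A B =
     (if A \<in> Cov \<and> B \<in> Cov
      then Inf {frob_norm (X - Y) | X Y :: real^'n^'n. X ** transpose X = A \<and> Y ** transpose Y = B}
      else 0)"

definition bw_H :: "real^'n^'n \<Rightarrow> real^'n^'n \<Rightarrow> real^'n^'n \<Rightarrow> real^'n^'n" where
  "bw_H X Y R = transpose X ** Y ** transpose R"

definition bw_curve ::
  "real^'n^'n \<Rightarrow> real^'n^'n \<Rightarrow> real^'n^'n \<Rightarrow> real^'n^'n \<Rightarrow> real^'n^'n \<Rightarrow> real \<Rightarrow> real^'n^'n"
  where
  "bw_curve A B X Y R t =
     (1 - t)\<^sup>2 *\<^sub>R A + t\<^sup>2 *\<^sub>R B + (2 * t * (1 - t)) *\<^sub>R sym_part (X ** R ** transpose Y)"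

section \<open>The Bures-Wasserstein distance is a metric\<close>

text \<open>This makes the notions of the locale \<open>Metric_space\<close> available for \<open>bw_dist\<close>.\<close>

lemma frob_norm_eq_norm: "frob_norm M = norm M"
proof -
  have "trace (transpose M ** M) = (\<Sum>i\<in>UNIV. \<Sum>j\<in>UNIV. (M$j$i)\<^sup>2)"
    by (simp add: trace_def matrix_matrix_mult_def transpose_def power2_eq_square)
  also have "\<dots> = (\<Sum>j\<in>UNIV. \<Sum>i\<in>UNIV. (M$j$i)\<^sup>2)" by (rule sum.swap)
  also have "\<dots> = M \<bullet> M" by (simp add: inner_vec_def power2_eq_square)
  finally show ?thesis unfolding frob_norm_def norm_eq_sqrt_inner by (rule arg_cong)
qed

lemma norm_transpose: "norm (transpose M) = norm (M :: real^'n^'n)"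
  using trace_mul_sym[of M "transpose M"]
  by (simp add: frob_norm_eq_norm[symmetric] frob_norm_def)

lemma mult_orthogonal_factor:
  fixes X Q :: "real^'n^'n"
  assumes "orthogonal_matrix Q"
  shows "(X ** Q) ** transpose (X ** Q) = X ** transpose X"
proof -
  have "(X ** Q) ** transpose (X ** Q) = X ** (Q ** transpose Q) ** transpose X"
    by (simp only: matrix_transpose_mul matrix_mul_assoc)
  then show ?thesis using assms by (simp add: orthogonal_matrix_def)
qed

lemma norm_mult_orthogonal:
  fixes M Q :: "real^'n^'n"
  assumes "orthogonal_matrix Q"
  shows "norm (M ** Q) = norm M"
proof -
  have "transpose (transpose (M ** Q)) ** transpose (M ** Q) = M ** transpose M"
    using mult_orthogonal_factor[OF assms, of M] by (simp only: transpose_transpose)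
  then have "norm (transpose (M ** Q)) = norm (transpose M)"
    unfolding frob_norm_eq_norm[symmetric] frob_norm_def by simp
  then show ?thesis by (simp add: norm_transpose)
qed

lemma Cov_factor:
  fixes A :: "real^'n^'n"
  assumes A: "A \<in> Cov"
  obtains X :: "real^'n^'n" where "X ** transpose X = A"
proof -
  define out :: "real^'n \<Rightarrow> real^'n^'n" where "out = (\<lambda>v. \<chi> i j. v$i * v$j)"
  have out_mult: "out v *v x = (v \<bullet> x) *\<^sub>R v" for v x
    by (simp add: out_def matrix_vector_mult_def vec_eq_iff inner_vec_def sum_distrib_right
        sum_distrib_left mult_ac)
  have step: "\<exists>v. B - out v \<in> Cov \<and> (\<forall>j. (B - out v)$i$j = 0)
      \<and> (\<forall>k. (\<forall>j. B$k$j = 0) \<longrightarrow> (\<forall>j. (B - out v)$k$j = 0))"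
    if B: "B \<in> Cov" for B :: "real^'n^'n" and i
  proof -
    have tr: "B$k$j = B$j$k" for j k
      using B by (metis (mono_tags, lifting) Cov_def mem_Collect_eq transpose_def vec_lambda_beta)
    define b where "b = B *v axis i 1"
    have b: "b$j = B$j$i" for j
      by (simp add: b_def matrix_vector_mult_def axis_def if_distrib cong: if_cong)
    have bx: "axis i 1 \<bullet> (B *v x) = b \<bullet> x" for x
    proof -
      have "axis i 1 \<bullet> (B *v x) = (B *v x) $ i" by (simp add: inner_axis')
      also have "\<dots> = b \<bullet> x" by (simp add: b inner_vec_def matrix_vector_mult_def tr[of i])
      finally show ?thesis .
    qed
    have quad: "0 \<le> x \<bullet> (B *v x) + 2 * s * (b \<bullet> x) + s\<^sup>2 * B$i$i" for x s
    proof -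
      have "0 \<le> (x + s *\<^sub>R axis i 1) \<bullet> (B *v (x + s *\<^sub>R axis i 1))"
        using B by (simp add: Cov_def)
      also have "\<dots> = x \<bullet> (B *v x) + s * (x \<bullet> b) + s * (axis i 1 \<bullet> (B *v x))
            + s\<^sup>2 * (axis i 1 \<bullet> b)"
        by (simp only: matrix_vector_right_distrib matrix_vector_mult_scaleR b_def[symmetric]
            inner_add_left inner_add_right inner_scaleR_left inner_scaleR_right
            power2_eq_square) (simp add: algebra_simps)
      finally show ?thesis
        unfolding bx by (simp only: inner_axis' b inner_commute[of x b])
          (simp add: algebra_simps)
    qed
    show ?thesis
    proof (cases "B$i$i = 0")
      case True
      have "b \<bullet> x = 0" for x
      proof (rule ccontr)
        assume n: "b \<bullet> x \<noteq> 0"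
        have "0 \<le> x \<bullet> (B *v x) + 2 * (- (x \<bullet> (B *v x) + 1) / (2 * (b \<bullet> x))) * (b \<bullet> x)"
          using quad[of x "- (x \<bullet> (B *v x) + 1) / (2 * (b \<bullet> x))"] True by simp
        also have "\<dots> = -1" using n by (simp add: field_simps)
        finally show False by simp
      qed
      then have "b = 0" using inner_eq_zero_iff by blast
      then have "B$i$j = 0" for j using b[of j] tr[of i j] by simp
      moreover have "out 0 = 0" by (simp add: out_def vec_eq_iff)
      ultimately show ?thesis using B by (intro exI[of _ 0]) auto
    next
      case False
      have pos: "B$i$i > 0"
      proof -
        have "0 \<le> axis i 1 \<bullet> (B *v axis i 1)" using B by (simp add: Cov_def)
        then show ?thesis using False by (simp add: bx inner_axis b less_le)
      qed
      define v where "v = (1 / sqrt (B$i$i)) *\<^sub>R b"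
      have vij: "out v $ j $ k = B$j$i * B$k$i / B$i$i" for j k
        using pos by (simp add: out_def v_def b field_simps)
      have "x \<bullet> (out v *v x) = (b \<bullet> x)\<^sup>2 / B$i$i" for x
        using pos by (simp add: out_mult v_def inner_commute power2_eq_square field_simps)
      moreover have "(b \<bullet> x)\<^sup>2 / B$i$i \<le> x \<bullet> (B *v x)" for x
        using quad[of x "- (b \<bullet> x) / B$i$i"] pos
        by (simp add: power2_eq_square field_simps)
      ultimately have "0 \<le> x \<bullet> ((B - out v) *v x)" for x
        by (simp add: matrix_vector_mult_diff_rdistrib inner_diff_right)
      moreover have "transpose (B - out v) = B - out v"
        by (simp add: transpose_def vec_eq_iff vij tr mult.commute)
      ultimately have "B - out v \<in> Cov" by (simp add: Cov_def)
      moreover have "(B - out v)$i$j = 0" for j using pos by (simp add: vij tr[of j i])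
      moreover have "(B - out v)$k$j = 0" if "\<forall>j. B$k$j = 0" for k j
        using that by (simp add: vij)
      ultimately show ?thesis by blast
    qed
  qed
  have "\<exists>V. A - (\<Sum>i\<in>S. out (V i)) \<in> Cov \<and> (\<forall>i\<in>S. \<forall>j. (A - (\<Sum>i\<in>S. out (V i)))$i$j = 0)"
    if "finite S" for S :: "'n set"
    using that
  proof (induction S rule: finite_induct)
    case empty
    then show ?case using A by simp
  next
    case (insert i S)
    then obtain V where V: "A - (\<Sum>i\<in>S. out (V i)) \<in> Cov"
      "\<And>k j. k \<in> S \<Longrightarrow> (A - (\<Sum>i\<in>S. out (V i)))$k$j = 0" by blast
    obtain v where v: "A - (\<Sum>i\<in>S. out (V i)) - out v \<in> Cov"
      "\<And>j. (A - (\<Sum>i\<in>S. out (V i)) - out v)$i$j = 0"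
      "\<And>k. (\<forall>j. (A - (\<Sum>i\<in>S. out (V i)))$k$j = 0)
          \<Longrightarrow> (\<forall>j. (A - (\<Sum>i\<in>S. out (V i)) - out v)$k$j = 0)"
      using step[OF V(1), of i] by blast
    have "(\<Sum>k\<in>S. out ((V(i := v)) k)) = (\<Sum>k\<in>S. out (V k))"
      using insert.hyps by (intro sum.cong) auto
    then have eq: "A - (\<Sum>k\<in>insert i S. out ((V(i := v)) k)) = A - (\<Sum>i\<in>S. out (V i)) - out v"
      using insert.hyps by simp
    show ?case
      by (rule exI[of _ "V(i := v)"], unfold eq) (use v V(2) in blast)
  qed
  from this[of UNIV] obtain V :: "'n \<Rightarrow> real^'n" where V: "\<And>i j. (A - (\<Sum>i\<in>UNIV. out (V i)))$i$j = 0"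
    using finite by blast
  have "A - (\<Sum>i\<in>UNIV. out (V i)) = 0"
    using V by (simp only: vec_eq_iff zero_index) simp
  then have "A = (\<Sum>i\<in>UNIV. out (V i))" by simp
  moreover have "(\<chi> j i. V i $ j) ** transpose (\<chi> j i. V i $ j) = (\<Sum>i\<in>UNIV. out (V i))"
    by (simp add: vec_eq_iff out_def matrix_matrix_mult_def transpose_def)
  ultimately show thesis using that by metis
qed

lemma factor_unique:
  fixes X Y :: "real^'n^'n"
  assumes eq: "X ** transpose X = Y ** transpose Y"
  obtains Q where "orthogonal_matrix Q" "Y = X ** Q"
proof -
  define f where "f = (\<lambda>v. transpose X *v v)"
  define g where "g = (\<lambda>v. transpose Y *v v)"
  have lin: "linear f" "linear g" unfolding f_def g_def by (rule matrix_vector_mul_linear)+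
  have gram: "(transpose M *v v) \<bullet> (transpose M *v v) = v \<bullet> ((M ** transpose M) *v v)"
    for M :: "real^'n^'n" and v
    by (metis dot_lmul_matrix matrix_vector_mul_assoc transpose_matrix_vector)
  have nfg: "norm (g v) = norm (f v)" for v
    unfolding norm_eq_sqrt_inner f_def g_def gram eq ..
  obtain h where h: "linear h" "\<And>v. v \<in> range f \<Longrightarrow> f (h v) = v"
    using real_vector.linear_exists_right_inverse_on[OF lin(1) subspace_UNIV] by auto
  define p where "p = g \<circ> h"
  have linp: "linear p" unfolding p_def by (rule linear_compose[OF h(1) lin(2)])
  have pn: "norm (p r) = norm r" if "r \<in> range f" for r
    using h(2)[OF that] by (simp add: p_def nfg)
  have pf: "p (f v) = g v" for v
  proof -
    have "norm (g (h (f v) - v)) = 0"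
      by (simp add: nfg linear_diff[OF lin(1)] h(2))
    then show ?thesis by (simp add: p_def linear_diff[OF lin(2)])
  qed
  define S where "S = range f"
  define S' where "S' = range g"
  have subS: "subspace S" "subspace S'"
    unfolding S_def S'_def using lin subspace_UNIV linear_subspace_image by blast+
  have pS: "p ` S = S'" unfolding S_def S'_def by (auto simp: pf image_image)
  have "inj_on p S"
    unfolding linear_injective_on_subspace_0[OF linp subS(1)]
    using pn S_def by (metis norm_eq_zero)
  then have dims: "dim S' = dim S"
    using dim_image_eq[OF linp, of S] subS(1) pS by (metis span_eq_iff)
  define T where "T = {z \<in> UNIV. \<forall>x\<in>S. orthogonal x z}"
  define T' where "T' = {z \<in> UNIV. \<forall>x\<in>S'. orthogonal x z}"
  have subT: "subspace T" "subspace T'"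
    unfolding T_def T'_def by (auto simp: subspace_def orthogonal_clauses)
  have "dim T = dim T'"
    using dim_subspace_orthogonal_to_vectors[OF subS(1) subspace_UNIV]
      dim_subspace_orthogonal_to_vectors[OF subS(2) subspace_UNIV] dims
    unfolding T_def T'_def by simp
  then obtain q where q: "linear q" "q ` T = T'" "\<And>x. x \<in> T \<Longrightarrow> norm (q x) = norm x"
    using isometries_subspaces[OF subT] by metis
  obtain B where B: "B \<subseteq> S" "pairwise orthogonal B" "\<And>x. x \<in> B \<Longrightarrow> norm x = 1" "span B = S"
    using orthonormal_basis_subspace[OF subS(1)] by metis
  obtain C where C: "C \<subseteq> T" "pairwise orthogonal C" "\<And>x. x \<in> C \<Longrightarrow> norm x = 1" "span C = T"
    using orthonormal_basis_subspace[OF subT(1)] by metis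
  have BC: "orthogonal x y" "orthogonal y x" if "x \<in> B" "y \<in> C" for x y
    using that B(1) C(1) unfolding T_def by (blast intro: orthogonal_commute[THEN iffD1])+
  have "pairwise orthogonal (B \<union> C)"
    using B(2) C(2) BC by (auto simp: pairwise_def)
  moreover have "0 \<notin> B \<union> C" using B(3) C(3) by force
  ultimately have ind: "independent (B \<union> C)" by (rule pairwise_orthogonal_independent)
  obtain F where F: "linear F" "\<And>x. x \<in> B \<union> C \<Longrightarrow> F x = (if x \<in> B then p x else q x)"
    using linear_independent_extend[OF ind, of "\<lambda>x. if x \<in> B then p x else q x"] by blast
  have FS: "F x = p x" if "x \<in> S" for x
    using linear_eq_on_span[OF F(1) linp, of B x] that F(2) B(4) by auto
  have disj: "x \<notin> B" if "x \<in> C" for x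
    using BC[of x x] that C(3)[of x] by (auto simp: orthogonal_def)
  have FT: "F x = q x" if "x \<in> T" for x
    using linear_eq_on_span[OF F(1) q(1), of C x] that F(2) C(4) disj by auto
  have "norm (F x) = norm x" for x
  proof -
    obtain y z where yz: "y \<in> span S" "\<And>w. w \<in> span S \<Longrightarrow> orthogonal z w" "x = y + z"
      using orthogonal_subspace_decomp_exists by metis
    have y: "y \<in> S" using yz(1) subS(1) by (metis span_eq_iff)
    have z: "z \<in> T" using yz(2) by (auto simp: T_def orthogonal_commute span_base)
    have "p y \<in> S'" "q z \<in> T'" using y z pS q(2) by auto
    then have "orthogonal (p y) (q z)" by (auto simp: T'_def)
    moreover have "orthogonal y z" using y z by (auto simp: T_def)
    moreover have "F x = p y + q z" by (simp add: yz(3) linear_add[OF F(1)] FS[OF y] FT[OF z])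
    ultimately have "(norm (F x))\<^sup>2 = (norm x)\<^sup>2"
      using pn[of y] q(3)[OF z] y yz(3) by (simp add: S_def norm_add_Pythagorean)
    then show ?thesis by simp
  qed
  then have "orthogonal_transformation F" using F(1) by (simp add: orthogonal_transformation)
  then have orth: "orthogonal_matrix (matrix F)" by (simp add: orthogonal_transformation_matrix)
  have "transpose Y *v v = (matrix F ** transpose X) *v v" for v
  proof -
    have matF: "matrix F *v x = F x" for x
      using orthogonal_transformation_matrix F(1) by (simp add: matrix_works linear_matrix_vector_mul_eq)
    have "F (f v) = g v" using FS[of "f v"] pf by (simp add: S_def)
    then show ?thesis
      by (simp add: f_def g_def matrix_vector_mul_assoc[symmetric] matF
          del: transpose_matrix_vector)
  qed
  then have "transpose Y = matrix F ** transpose X" unfolding matrix_eq by blast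
  then have "Y = X ** transpose (matrix F)"
    by (metis matrix_transpose_mul transpose_transpose)
  then show thesis using that orth orthogonal_matrix_transpose by blast
qed

lemma bw_dist_le:
  fixes A B X Y :: "real^'n^'n"
  assumes "A \<in> Cov" "B \<in> Cov" "X ** transpose X = A" "Y ** transpose Y = B"
  shows "bw_dist A B \<le> norm (X - Y)"
proof -
  have "Inf {norm (X - Y) | X Y :: real^'n^'n. X ** transpose X = A \<and> Y ** transpose Y = B}
      \<le> norm (X - Y)"
  proof (rule cInf_lower)
    show "norm (X - Y) \<in> {norm (X - Y) | X Y :: real^'n^'n.
        X ** transpose X = A \<and> Y ** transpose Y = B}"
      using assms(3,4) by blast
    show "bdd_below {norm (X - Y) | X Y :: real^'n^'n.
        X ** transpose X = A \<and> Y ** transpose Y = B}"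
      by (rule bdd_belowI[of _ 0]) (elim CollectE exE conjE, simp only: norm_ge_zero)
  qed
  then show ?thesis using assms(1,2) unfolding bw_dist_def frob_norm_eq_norm by (simp only: simp_thms if_True)
qed

lemma bw_dist_approx:
  fixes A B X :: "real^'n^'n"
  assumes "A \<in> Cov" "B \<in> Cov" "e > 0" "X ** transpose X = A"
  obtains Y where "Y ** transpose Y = B" "norm (X - Y) < bw_dist A B + e"
proof -
  let ?S = "{norm (X - Y) | X Y :: real^'n^'n. X ** transpose X = A \<and> Y ** transpose Y = B}"
  have "?S \<noteq> {}"
  proof -
    obtain Y :: "real^'n^'n" where "Y ** transpose Y = B" using Cov_factor[OF assms(2)] .
    then show ?thesis using assms(4) by blast
  qed
  moreover have "Inf ?S < bw_dist A B + e"
  proof -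
    have "bw_dist A B = Inf ?S"
      using assms(1,2) unfolding bw_dist_def frob_norm_eq_norm by (simp only: simp_thms if_True)
    then show ?thesis using assms(3) by linarith
  qed
  ultimately obtain s where "s \<in> ?S" "s < bw_dist A B + e"
    by (metis (no_types, lifting) cInf_lessD)
  then obtain X' Y' :: "real^'n^'n" where XY: "X' ** transpose X' = A" "Y' ** transpose Y' = B"
    "norm (X' - Y') < bw_dist A B + e" by blast
  obtain Q where Q: "orthogonal_matrix Q" "X = X' ** Q"
    using factor_unique[of X' X] XY(1) assms(4) by metis
  have "X - Y' ** Q = (X' - Y') ** Q"
    by (simp add: Q(2) matrix_matrix_mult_def vec_eq_iff left_diff_distrib sum_subtractf)
  then have "norm (X - Y' ** Q) = norm (X' - Y')"
    by (simp add: norm_mult_orthogonal[OF Q(1)])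
  then show thesis
    using that[of "Y' ** Q"] XY mult_orthogonal_factor[OF Q(1), of Y'] by simp
qed

lemma bw_dist_nonneg: "0 \<le> bw_dist A (B :: real^'n^'n)"
proof (cases "A \<in> Cov \<and> B \<in> Cov")
  case True
  then obtain X Y :: "real^'n^'n" where "X ** transpose X = A" "Y ** transpose Y = B"
    using Cov_factor by metis
  then have "0 \<le> Inf {norm (X - Y) | X Y :: real^'n^'n.
      X ** transpose X = A \<and> Y ** transpose Y = B}"
    by (intro cInf_greatest) (blast, elim CollectE exE conjE, simp only: norm_ge_zero)
  then show ?thesis using True by (simp add: bw_dist_def frob_norm_eq_norm)
next
  case False
  then show ?thesis unfolding bw_dist_def by (simp only: if_False order_refl)
qed

lemma bw_dist_commute: "bw_dist A B = bw_dist B A"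
proof -
  have "{frob_norm (X - Y) | X Y. X ** transpose X = A \<and> Y ** transpose Y = B}
      = {frob_norm (X - Y) | X Y. X ** transpose X = B \<and> Y ** transpose Y = A}"
    unfolding frob_norm_eq_norm by (auto; metis norm_minus_commute)
  then show ?thesis by (auto simp: bw_dist_def)
qed

theorem Metric_space_bw: "Metric_space (Cov :: (real^'n^'n) set) bw_dist"
proof
  fix A B C :: "real^'n^'n"
  show "0 \<le> bw_dist A B" by (rule bw_dist_nonneg)
  show "bw_dist A B = bw_dist B A" by (rule bw_dist_commute)
  show "bw_dist A B = 0 \<longleftrightarrow> A = B" if AB: "A \<in> Cov" "B \<in> Cov"
  proof
    assume zero: "bw_dist A B = 0"
    obtain X :: "real^'n^'n" where X: "X ** transpose X = A" using Cov_factor[OF AB(1)] .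
    have "\<exists>Y. Y ** transpose Y = B \<and> norm (X - Y) < 1 / Suc n" for n
      using bw_dist_approx[OF AB _ X, of "1 / Suc n"] zero
      by (metis add_0 of_nat_0_less_iff zero_less_Suc zero_less_divide_1_iff)
    then obtain Y where Y: "\<And>n. Y n ** transpose (Y n) = B" "\<And>n. norm (X - Y n) < 1 / Suc n"
      by metis
    have "(\<lambda>n. Y n - X) \<longlonglongrightarrow> 0"
    proof (rule Lim_null_comparison)
      show "\<forall>\<^sub>F n in sequentially. norm (Y n - X) \<le> 1 / Suc n"
        using Y(2) by (intro always_eventually allI) (metis less_imp_le norm_minus_commute)
      show "(\<lambda>n. 1 / real (Suc n)) \<longlonglongrightarrow> 0"
        using LIMSEQ_Suc[OF lim_1_over_n] by simp
    qed
    then have lim: "Y \<longlonglongrightarrow> X" by (rule LIM_zero_cancel)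
    have "(\<lambda>n. Y n ** transpose (Y n)) \<longlonglongrightarrow> X ** transpose X"
      unfolding matrix_matrix_mult_def transpose_def
      by (intro tendsto_vec_lambda tendsto_sum tendsto_mult)
         (simp_all add: tendsto_vec_nth lim)
    then show "A = B" using X Y(1) by (simp add: LIMSEQ_const_iff)
  next
    assume "A = B"
    moreover obtain X :: "real^'n^'n" where "X ** transpose X = A" using Cov_factor[OF AB(1)] .
    ultimately have "bw_dist A B \<le> 0" using bw_dist_le[of A B X X] AB by simp
    then show "bw_dist A B = 0" using bw_dist_nonneg[of A B] by simp
  qed
  show "bw_dist A C \<le> bw_dist A B + bw_dist B C" if ABC: "A \<in> Cov" "B \<in> Cov" "C \<in> Cov"
  proof (rule field_le_epsilon)
    fix e :: real assume "e > 0"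
    then have e: "e / 2 > 0" by simp
    obtain X :: "real^'n^'n" where X: "X ** transpose X = A" using Cov_factor[OF ABC(1)] .
    obtain Y :: "real^'n^'n" where Y: "Y ** transpose Y = B" "norm (X - Y) < bw_dist A B + e / 2"
      using bw_dist_approx[OF ABC(1,2) e X] .
    obtain Z :: "real^'n^'n" where Z: "Z ** transpose Z = C" "norm (Y - Z) < bw_dist B C + e / 2"
      using bw_dist_approx[OF ABC(2,3) e Y(1)] .
    have "bw_dist A C \<le> norm (X - Z)" by (rule bw_dist_le[OF ABC(1,3) X Z(1)])
    also have "\<dots> \<le> norm (X - Y) + norm (Y - Z)" using norm_triangle_ineq[of "X - Y" "Y - Z"] by simp
    finally show "bw_dist A C \<le> bw_dist A B + bw_dist B C + e" using Y(2) Z(2) by simp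
  qed
qed

interpretation BW: Metric_space "Cov :: (real^'n^'n) set" bw_dist
  by (rule Metric_space_bw)

end

theory Submission
  imports Defs
begin

text \<open>The map \<open>X \<mapsto> X ** transpose X\<close> sends the Euclidean space of matrices onto \<open>Cov\<close>, and the
  Bures-Wasserstein distance is the distance between its fibres. Each fibre is an orbit
  \<open>{X ** Q | Q orthogonal}\<close>, and right multiplication by \<open>Q\<close> is an isometry. So geodesics
  should be the images of straight segments that realise the distance between two fibres, and
  everything rests on recognising these segments.

  Expanding \<open>norm (X - Y ** Q)\<close>, the pair \<open>X, Y\<close> realises the distance iff \<open>Q = mat 1\<close> maximises
  \<open>trace (H ** Q)\<close> over the orthogonal matrices, where \<open>H = transpose X ** Y\<close>. This holds iff \<open>H\<close>
  is positive semi-definite: sufficiency is the Cauchy-Schwarz inequality, and necessity follows by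
  testing with one Householder reflection (positivity) and with products of two (symmetry). This is
  \<open>bw_dist_eq_norm_iff\<close>; factors with \<open>transpose X ** Y \<in> Cov\<close> are called aligned below. By
  the triangle inequality, the image of an aligned segment is a geodesic (\<open>aligned_segment_dist\<close>).

  For the converse, let \<open>\<gamma>\<close> be a geodesic. Lifting the points \<open>\<gamma> 0\<close>, \<open>\<gamma> (1/2)\<close>, \<open>\<gamma> 1\<close> in turn to
  nearest points of the fibres gives collinear points \<open>X\<close>, \<open>Z\<close>, \<open>Y\<close>, because the distances add
  up (\<open>lift_of_metric_segment\<close>). The same construction applied to another time \<open>t\<close> yields
  an aligned segment that might depend on \<open>t\<close>. It does not: although a pair of covariance matrices may be
  joined by many geodesics, an aligned segment is determined by any one of its interior points and
  the fibres of its endpoints (\<open>aligned_extension_unique\<close>). Lifting both halves of \<open>\<gamma>\<close> from the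
  midpoint \<open>Z\<close> therefore always leads back to the one segment from \<open>X\<close> to \<open>Y\<close>, and \<open>Y\<close> differs
  from the given factor of \<open>\<gamma> 1\<close> by an orthogonal matrix.

  The formula for \<open>H\<close> is the uniqueness of the positive semi-definite square root. The rank is
  constant because the kernel of an interior point of an aligned segment is the intersection of the
  kernels of the two endpoints (\<open>aligned_segment_kernel\<close>).\<close>

section \<open>Minimizing geodesics in a metric space\<close>

context Metric_space
begin

lemma curve_length_of_proportional_dist:
  assumes "a \<le> b"
    and lin: "\<And>s t. a \<le> s \<Longrightarrow> s \<le> t \<Longrightarrow> t \<le> b \<Longrightarrow> d (c s) (c t) = v * (t - s)"
  shows "curve_length c a b = ereal (v * (b - a))"
proof -
  let ?P = "{(N :: nat, t :: nat \<Rightarrow> real). t 0 = a \<and> t N = b \<and> (\<forall>i<N. t i \<le> t (Suc i))}"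
  have "(\<Sum>i<N. d (c (t i)) (c (t (Suc i)))) = v * (b - a)" if "(N, t) \<in> ?P" for N t
  proof -
    have t: "t 0 = a" "t N = b" "\<And>i. i < N \<Longrightarrow> t i \<le> t (Suc i)" using that by auto
    have mono: "t i \<le> t j" if "i \<le> j" "j \<le> N" for i j
      using that
    proof (induction j rule: dec_induct)
      case (step j)
      then show ?case using t(3)[of j] by simp
    qed simp
    have "(\<Sum>i<N. d (c (t i)) (c (t (Suc i)))) = (\<Sum>i<N. v * (t (Suc i) - t i))"
    proof (intro sum.cong refl lin)
      fix i assume "i \<in> {..<N}"
      then have "i < N" by simp
      then show "a \<le> t i" "t i \<le> t (Suc i)" "t (Suc i) \<le> b"
        using mono[of 0 i] mono[of "Suc i" N] t by simp_all
    qed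
    also have "\<dots> = v * (b - a)"
      by (simp add: sum_distrib_left[symmetric] sum_lessThan_telescope t)
    finally show ?thesis .
  qed
  then have "curve_length c a b = (SUP (N, t) \<in> ?P. ereal (v * (b - a)))"
    unfolding curve_length_def by (intro SUP_cong refl) auto
  moreover have "(1, \<lambda>i. if i = 0 then a else b) \<in> ?P" using \<open>a \<le> b\<close> by auto
  then have "?P \<noteq> {}" by blast
  ultimately show ?thesis by (simp add: case_prod_unfold)
qed

text \<open>This removes lengths of curves from the problem: a minimizing curve has \<open>d (c s) (c t)\<close> equal to its
  length, so constant speed says that distances are proportional to parameter differences.
  Conversely, the sums over subdivisions then telescope.\<close>
lemma minimizing_geodesic_on_unit_interval_iff:
  fixes c :: "real \<Rightarrow> 'a"
  shows "minimizing_geodesic_on {0..1} c \<longleftrightarrow>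
     c ` {0..1} \<subseteq> M \<and>
     (\<forall>s\<in>{0..1}. \<forall>t\<in>{0..1}. s \<le> t \<longrightarrow> d (c s) (c t) = d (c 0) (c 1) * (t - s))"
    (is "_ \<longleftrightarrow> _ \<and> ?lin")
proof
  assume g: "minimizing_geodesic_on {0..1} c"
  then obtain v where v: "\<And>s t. s \<in> {0..1} \<Longrightarrow> t \<in> {0..1} \<Longrightarrow> s \<le> t
      \<Longrightarrow> curve_length c s t = ereal (v * (t - s))"
    unfolding minimizing_geodesic_on_def constant_speed_on_def by blast
  have dv: "d (c s) (c t) = v * (t - s)" if "s \<in> {0..1}" "t \<in> {0..1}" "s \<le> t" for s t
    using g v[OF that] that unfolding minimizing_geodesic_on_def minimizing_on_def by simp
  have "c ` {0..1} \<subseteq> M"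
    using g continuous_map_image_subset_topspace
    unfolding minimizing_geodesic_on_def curve_on_def by fastforce
  moreover have "v = d (c 0) (c 1)" using dv[of 0 1] by simp
  ultimately show "c ` {0..1} \<subseteq> M \<and> ?lin" using dv by blast
next
  assume "c ` {0..1} \<subseteq> M \<and> ?lin"
  then have M: "\<And>t. t \<in> {0..1} \<Longrightarrow> c t \<in> M" and lin: ?lin by blast+
  define v where "v = d (c 0) (c 1)"
  have "v \<ge> 0" by (simp add: v_def)
  have dv: "d (c s) (c t) = v * \<bar>s - t\<bar>" if "s \<in> {0..1}" "t \<in> {0..1}" for s t
  proof (cases "s \<le> t")
    case True
    then have "d (c s) (c t) = v * (t - s)" using lin that v_def by blast
    then show ?thesis using True by simp
  next
    case False
    then have "t \<le> s" by simp
    then have "d (c t) (c s) = v * (s - t)" using lin that v_def by blast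
    then show ?thesis using False by (simp add: commute)
  qed
  have len: "curve_length c a b = ereal (v * (b - a))"
    if "a \<in> {0..1}" "b \<in> {0..1}" "a \<le> b" for a b
    using that by (intro curve_length_of_proportional_dist) (auto simp: dv)
  have "continuous_map (top_of_set {0..1}) mtopology c"
    unfolding continuous_map_to_metric
  proof (intro ballI allI impI)
    fix x e :: real assume x: "x \<in> topspace (top_of_set {0..1})" and "e > 0"
    \<comment> \<open>Adding \<open>1\<close> to \<open>v\<close> covers the constant curve, where \<open>v = 0\<close>.\<close>
    define U where "U = {0..1} \<inter> ball x (e / (v + 1))"
    have "openin (top_of_set {0..1}) U"
      unfolding U_def by (rule openin_open_Int) simp
    moreover have "x \<in> U" using x \<open>e > 0\<close> \<open>v \<ge> 0\<close> by (simp add: U_def)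
    moreover have "c y \<in> mball (c x) e" if "y \<in> U" for y
    proof -
      have "\<bar>x - y\<bar> * (v + 1) < e"
        using that \<open>v \<ge> 0\<close> by (simp add: U_def dist_real_def field_simps)
      then have "v * \<bar>x - y\<bar> < e" by (simp add: algebra_simps)
      then show ?thesis using that x M dv[of x y] by (auto simp: U_def in_mball)
    qed
    ultimately show "\<exists>U. openin (top_of_set {0..1}) U \<and> x \<in> U \<and> (\<forall>y\<in>U. c y \<in> mball (c x) e)"
      by blast
  qed
  then have "curve_on {0..1} c" by (simp add: curve_on_def is_interval_cc)
  moreover have "minimizing_on {0..1} c"
    unfolding minimizing_on_def by (intro ballI impI) (simp add: len dv)
  moreover have "constant_speed_on {0..1} c"
    unfolding constant_speed_on_def using \<open>v \<ge> 0\<close> len by blast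
  ultimately show "minimizing_geodesic_on {0..1} c" by (simp add: minimizing_geodesic_on_def)
qed

end

section \<open>The trace inner product and positive semi-definite matrices\<close>

lemma transpose_add: "transpose (A + B) = transpose A + transpose (B :: real^'n^'m)"
  by (simp add: vec_eq_iff transpose_def)

lemma transpose_diff: "transpose (A - B) = transpose A - transpose (B :: real^'n^'m)"
  by (simp add: vec_eq_iff transpose_def)

lemma matrix_diff_ldistrib: "A ** (B - C) = A ** B - A ** (C :: real^'n^'m)"
  by (simp add: vec_eq_iff matrix_matrix_mult_def right_diff_distrib sum_subtractf)

lemma matrix_diff_rdistrib: "(A - B) ** C = A ** C - B ** (C :: real^'n^'m)"
  by (simp add: vec_eq_iff matrix_matrix_mult_def left_diff_distrib sum_subtractf)

lemma matrix_add_rdistrib: "(A + B) ** C = A ** C + B ** (C :: real^'n^'m)"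
  by (simp add: vec_eq_iff matrix_matrix_mult_def distrib_right sum.distrib)

lemma matrix_mult_scaleR_left: "(r *\<^sub>R A) ** C = r *\<^sub>R (A ** (C :: real^'n^'m))"
  by (simp add: vec_eq_iff matrix_matrix_mult_def sum_distrib_left mult_ac)

lemma matrix_mult_scaleR_right: "A ** (r *\<^sub>R C) = r *\<^sub>R (A ** (C :: real^'n^'m))"
  by (simp add: vec_eq_iff matrix_matrix_mult_def sum_distrib_left mult_ac)

lemmas matrix_ring_simps = transpose_add transpose_diff transpose_scalar matrix_transpose_mul
  matrix_add_ldistrib matrix_add_rdistrib matrix_diff_ldistrib matrix_diff_rdistrib
  matrix_mult_scaleR_left matrix_mult_scaleR_right

lemma inner_matrix_eq_trace: "A \<bullet> B = trace (transpose A ** (B :: real^'n^'m))"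
proof -
  have "trace (transpose A ** B) = (\<Sum>i\<in>UNIV. \<Sum>j\<in>UNIV. A$j$i * B$j$i)"
    by (simp add: trace_def matrix_matrix_mult_def transpose_def)
  also have "\<dots> = (\<Sum>j\<in>UNIV. \<Sum>i\<in>UNIV. A$j$i * B$j$i)" by (rule sum.swap)
  finally show ?thesis by (simp add: inner_vec_def)
qed

lemma inner_transpose: "transpose A \<bullet> transpose B = A \<bullet> (B :: real^'n^'m)"
proof -
  have "transpose A \<bullet> transpose B = (\<Sum>i\<in>UNIV. \<Sum>j\<in>UNIV. A$j$i * B$j$i)"
    by (simp add: inner_vec_def transpose_def)
  also have "\<dots> = (\<Sum>j\<in>UNIV. \<Sum>i\<in>UNIV. A$j$i * B$j$i)" by (rule sum.swap)
  finally show ?thesis by (simp add: inner_vec_def)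
qed

lemma inner_matrix_mult_left: "(A ** B) \<bullet> C = B \<bullet> (transpose A ** (C :: real^'n^'m))"
  by (simp add: inner_matrix_eq_trace matrix_transpose_mul matrix_mul_assoc)

lemma inner_matrix_mult_right: "(A ** B) \<bullet> C = A \<bullet> ((C :: real^'n^'m) ** transpose B)"
proof -
  have "(A ** B) \<bullet> C = (transpose B ** transpose A) \<bullet> transpose C"
    using inner_transpose[of "A ** B" C] by (simp add: matrix_transpose_mul)
  also have "\<dots> = transpose A \<bullet> transpose (C ** transpose B)"
    by (simp add: inner_matrix_mult_left matrix_transpose_mul)
  finally show ?thesis by (simp only: inner_transpose)
qed

lemma inner_matrix_vector_left: "(A *v x) \<bullet> y = x \<bullet> (transpose A *v (y :: real^'m))"
  by (metis dot_lmul_matrix transpose_transpose transpose_matrix_vector)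

lemma gram_in_Cov: "V ** transpose V \<in> (Cov :: (real^'n^'n) set)"
  by (simp add: Cov_def matrix_ring_simps matrix_vector_mul_assoc[symmetric]
      inner_matrix_vector_left[symmetric] inner_commute del: transpose_matrix_vector)
    (metis inner_ge_zero inner_matrix_vector_left transpose_transpose)

lemma Cov_transpose: "A \<in> Cov \<Longrightarrow> transpose A = A"
  by (simp add: Cov_def)

lemma Cov_inner_ge_0:
  assumes "A \<in> Cov"
  shows "0 \<le> D \<bullet> (A ** (D :: real^'n^'n))"
proof -
  obtain V :: "real^'n^'n" where "V ** transpose V = A" using Cov_factor[OF assms] .
  then have "D \<bullet> (A ** D) = (transpose V ** D) \<bullet> (transpose V ** D)"
    by (metis inner_matrix_mult_left matrix_mul_assoc transpose_transpose)
  then show ?thesis by simp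
qed

text \<open>With \<open>A = V ** transpose V\<close>, the hypothesis says that \<open>transpose V ** D\<close> has norm zero.\<close>
lemma Cov_inner_eq_0D:
  assumes "A \<in> Cov" "D \<bullet> (A ** (D :: real^'n^'n)) = 0"
  shows "A ** D = 0"
proof -
  obtain V :: "real^'n^'n" where V: "V ** transpose V = A" using Cov_factor[OF assms(1)] .
  then have "D \<bullet> (A ** D) = (transpose V ** D) \<bullet> (transpose V ** D)"
    by (metis inner_matrix_mult_left matrix_mul_assoc transpose_transpose)
  then have "transpose V ** D = 0" using assms(2) by simp
  then have "V ** (transpose V ** D) = 0" by (simp add: matrix_matrix_mult_def vec_eq_iff)
  then show ?thesis using V by (simp add: matrix_mul_assoc)
qed

text \<open>With \<open>D = B - C\<close> one has \<open>B ** D + D ** C = 0\<close>; pairing with \<open>D\<close>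
  gives a sum of two nonnegative numbers, so \<open>B ** D = 0\<close> and \<open>C ** D = 0\<close>, whence \<open>D ** D = 0\<close>.\<close>
lemma Cov_square_inject:
  assumes "B \<in> Cov" "C \<in> Cov" "B ** B = C ** (C :: real^'n^'n)"
  shows "B = C"
proof -
  define D where "D = B - C"
  have sym: "transpose D = D" using assms(1,2) by (simp add: D_def transpose_diff Cov_transpose)
  have "B ** D + D ** C = 0" using assms(3) by (simp add: D_def matrix_ring_simps)
  then have "D \<bullet> (B ** D) + D \<bullet> (D ** C) = 0" by (metis inner_add_right inner_zero_right)
  moreover have "D \<bullet> (D ** C) = D \<bullet> (C ** D)"
    using inner_transpose[of D "D ** C"] assms(2) sym by (simp add: matrix_transpose_mul Cov_transpose)
  ultimately have "D \<bullet> (B ** D) = 0" "D \<bullet> (C ** D) = 0"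
    using Cov_inner_ge_0[OF assms(1), of D] Cov_inner_ge_0[OF assms(2), of D] by linarith+
  then have "B ** D = 0" "C ** D = 0" using Cov_inner_eq_0D assms by blast+
  then have "D ** D = 0" by (simp add: D_def matrix_ring_simps)
  then have "D \<bullet> D = 0" by (simp add: inner_matrix_eq_trace sym trace_0[unfolded mat_0])
  then show ?thesis by (simp add: D_def)
qed

lemma cov_sqrt_eqI:
  assumes "B \<in> Cov" "B ** B = A"
  shows "cov_sqrt A = B"
  unfolding cov_sqrt_def using assms by (intro the_equality) (auto intro: Cov_square_inject)

section \<open>Optimal alignment\<close>

definition outer_product :: "real^'n \<Rightarrow> real^'n^'n" where
  "outer_product v = (\<chi> i j. v$i * v$j)"

definition reflection :: "real^'n \<Rightarrow> real^'n^'n" where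
  "reflection v = mat 1 - (2 / (v \<bullet> v)) *\<^sub>R outer_product v"

lemma outer_product_mult_vector: "outer_product v *v x = (v \<bullet> x) *\<^sub>R v"
  by (simp add: outer_product_def matrix_vector_mult_def vec_eq_iff inner_vec_def
      sum_distrib_right sum_distrib_left mult_ac)

lemma orthogonal_matrix_reflection: "orthogonal_matrix (reflection v)"
proof -
  have sym: "transpose (outer_product v) = outer_product v"
    by (simp add: outer_product_def transpose_def vec_eq_iff mult.commute)
  have "outer_product v ** outer_product v = (v \<bullet> v) *\<^sub>R outer_product v"
    by (simp add: matrix_eq matrix_vector_mul_assoc[symmetric] outer_product_mult_vector
        matrix_vector_mult_scaleR scaleR_matrix_vector_assoc[symmetric] mult.commute)
  then show ?thesis
    by (cases "v = 0")
      (simp_all add: orthogonal_matrix reflection_def matrix_ring_simps sym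
        scaleR_2 scaleR_diff_right scaleR_add_right)
qed

lemma reflection_mult_vector: "reflection v *v x = x - (2 * (v \<bullet> x) / (v \<bullet> v)) *\<^sub>R v"
  by (simp add: reflection_def matrix_vector_mult_diff_rdistrib
      scaleR_matrix_vector_assoc[symmetric] outer_product_mult_vector)

lemma trace_mult_reflection:
  "trace (A ** reflection v) = trace A - 2 * (v \<bullet> (A *v v)) / (v \<bullet> v)"
proof -
  have "trace (A ** outer_product v) = v \<bullet> (A *v v)"
    by (simp add: trace_def matrix_matrix_mult_def outer_product_def inner_vec_def
        matrix_vector_mult_def sum_distrib_left mult_ac)
  moreover have "trace (r *\<^sub>R B) = r * trace B" for r and B :: "real^'a^'a"
    by (simp add: trace_def sum_distrib_left)
  ultimately show ?thesis by (simp add: reflection_def matrix_ring_simps trace_sub)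
qed

text \<open>Testing with the reflection along \<open>v\<close> changes the trace by a negative multiple of \<open>v \<bullet> (H *v v)\<close>.
  A product of two reflections, along \<open>u + s *\<^sub>R w\<close> and \<open>u\<close>, is a rotation by an angle of order
  \<open>s\<close>; to first order in \<open>s\<close> it sees the antisymmetric part of \<open>H\<close>.\<close>
lemma Cov_if_trace_maximal:
  fixes H :: "real^'n^'n"
  assumes max: "\<And>Q. orthogonal_matrix Q \<Longrightarrow> trace (H ** Q) \<le> trace H"
  shows "H \<in> Cov"
proof -
  have pos: "0 \<le> v \<bullet> (H *v v)" for v
    using max[OF orthogonal_matrix_reflection, of v]
    by (cases "v = 0") (auto simp: trace_mult_reflection zero_le_divide_iff dest: antisym[OF _ inner_ge_zero])
  \<comment> \<open>The inequality for reflections along \<open>u\<close> and \<open>v\<close>, multiplied by \<open>(u \<bullet> u) * (v \<bullet> v)\<close>.\<close>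
  have two: "0 \<le> (v \<bullet> v) * (u \<bullet> (H *v u)) + (u \<bullet> u) * (v \<bullet> (H *v v))
      - 2 * (u \<bullet> v) * (v \<bullet> (H *v u))" for u v
  proof (cases "u = 0 \<or> v = 0")
    case False
    then have p: "u \<bullet> u > 0" "v \<bullet> v > 0" by auto
    have "trace (H ** reflection u ** reflection v) \<le> trace H"
      using max[OF orthogonal_matrix_mul[OF orthogonal_matrix_reflection orthogonal_matrix_reflection]]
      by (simp add: matrix_mul_assoc)
    then have "0 \<le> (u \<bullet> (H *v u)) / (u \<bullet> u) + (v \<bullet> (H *v v)) / (v \<bullet> v)
        - 2 * (u \<bullet> v) * (v \<bullet> (H *v u)) / (u \<bullet> u) / (v \<bullet> v)"
      by (simp add: trace_mult_reflection matrix_vector_mul_assoc[symmetric] reflection_mult_vector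
          matrix_vector_mult_diff_distrib matrix_vector_mult_scaleR inner_diff_right
          diff_divide_distrib)
    from mult_nonneg_nonneg[OF _ this, of "(u \<bullet> u) * (v \<bullet> v)"] p show ?thesis
      by (simp add: field_simps)
  qed auto
  have le: "0 \<le> u \<bullet> (H *v w) - w \<bullet> (H *v u)" if u: "u \<noteq> 0" for u w
  proof -
    \<comment> \<open>For the vectors \<open>u + s *\<^sub>R w\<close> and \<open>u\<close>, the inequality reads \<open>0 \<le> s * \<delta> + s\<^sup>2 * C\<close>.\<close>
    define \<delta> where "\<delta> = (u \<bullet> u) * (u \<bullet> (H *v w) - w \<bullet> (H *v u))"
    define C where "C = (w \<bullet> w) * (u \<bullet> (H *v u)) + (u \<bullet> u) * (w \<bullet> (H *v w))
        - 2 * (u \<bullet> w) * (w \<bullet> (H *v u))"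
    have "0 \<le> s * \<delta> + s\<^sup>2 * C" for s
      using two[of "u + s *\<^sub>R w" u] unfolding \<delta>_def C_def
      by (simp add: matrix_vector_right_distrib matrix_vector_mult_scaleR inner_add_left
          inner_add_right inner_commute[of w u] power2_eq_square algebra_simps)
    then have *: "0 \<le> \<delta> + s * C" if "s > 0" for s
      using that by (metis (no_types, opaque_lifting) distrib_left mult.assoc power2_eq_square
          zero_le_mult_iff less_le_not_le)
    have "0 \<le> \<delta>"
    proof (rule ccontr)
      assume "\<not> 0 \<le> \<delta>"
      then have d: "\<delta> < 0" by simp
      \<comment> \<open>This \<open>s\<close> makes \<open>s * C\<close> at most \<open>- \<delta> / 2\<close>; adding \<open>1\<close> avoids division by zero.\<close>
      define s where "s = - \<delta> / (2 * (\<bar>C\<bar> + 1))"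
      have "s > 0" using d by (simp add: s_def field_simps)
      have "s * C \<le> s * (\<bar>C\<bar> + 1)" using \<open>s > 0\<close> by (intro mult_left_mono) auto
      also have "\<dots> = - \<delta> / 2" by (simp add: s_def field_simps)
      finally show False using *[OF \<open>s > 0\<close>] d by linarith
    qed
    moreover have "u \<bullet> u > 0" using u by simp
    ultimately show ?thesis unfolding \<delta>_def by (metis mult_le_cancel_left_pos mult_zero_right)
  qed
  have sym: "u \<bullet> (H *v w) = w \<bullet> (H *v u)" for u w
    using le[of u w] le[of w u] by (cases "u = 0"; cases "w = 0") auto
  have "transpose H = H"
    by (rule vec_eq_iff[THEN iffD2], intro allI, rule vec_eq_iff[THEN iffD2])
      (use sym[of "axis _ 1" "axis _ 1"] in
        \<open>simp add: transpose_def inner_axis' matrix_vector_mult_basis column_def\<close>)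
  then show ?thesis using pos by (simp add: Cov_def)
qed

text \<open>With \<open>H = V ** transpose V\<close>, this is the Cauchy-Schwarz inequality for \<open>V\<close> and \<open>Q ** V\<close>,
  which have the same norm.\<close>
lemma Cov_trace_maximal:
  fixes H Q :: "real^'n^'n"
  assumes "H \<in> Cov" "orthogonal_matrix Q"
  shows "trace (H ** Q) \<le> trace H"
proof -
  obtain V :: "real^'n^'n" where V: "V ** transpose V = H" using Cov_factor[OF assms(1)] .
  have "trace (H ** Q) = trace (transpose V ** (Q ** V))"
    unfolding V[symmetric] by (metis matrix_mul_assoc trace_mul_sym)
  also have "\<dots> = V \<bullet> (Q ** V)" by (simp add: inner_matrix_eq_trace)
  also have "\<dots> \<le> norm V * norm (Q ** V)" by (rule norm_cauchy_schwarz)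
  also have "norm (Q ** V) = norm V"
    using norm_mult_orthogonal[of "transpose Q" "transpose V"] assms(2)
    by (metis matrix_transpose_mul norm_transpose orthogonal_matrix_transpose)
  also have "norm V * norm V = trace H"
    by (metis V inner_matrix_eq_trace norm_eq_square norm_ge_zero power2_eq_square power2_norm_eq_inner trace_mul_sym)
  finally show ?thesis .
qed

lemma norm_diff_le_mult_orthogonal_iff:
  fixes X Y Q :: "real^'n^'n"
  assumes "orthogonal_matrix Q"
  shows "norm (X - Y) \<le> norm (X - Y ** Q)
     \<longleftrightarrow> trace (transpose X ** Y ** Q) \<le> trace (transpose X ** Y)"
proof -
  have sq: "(norm (X - Z))\<^sup>2 = (norm X)\<^sup>2 + (norm Z)\<^sup>2 - 2 * trace (transpose X ** Z)"
    for Z :: "real^'n^'n"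
    unfolding power2_norm_eq_inner inner_matrix_eq_trace[of X Z, symmetric]
    by (simp add: inner_diff_left inner_diff_right inner_commute[of Z X])
  have "norm (X - Y) \<le> norm (X - Y ** Q) \<longleftrightarrow> (norm (X - Y))\<^sup>2 \<le> (norm (X - Y ** Q))\<^sup>2"
    by simp
  then show ?thesis unfolding sq by (simp add: norm_mult_orthogonal[OF assms] matrix_mul_assoc)
qed

lemma gram_mult_orthogonalE:
  fixes Y Y' :: "real^'n^'n"
  assumes "Y' ** transpose Y' = Y ** transpose Y"
  obtains Q where "orthogonal_matrix Q" "Y' = Y ** Q"
  using factor_unique[of Y Y'] assms by metis

lemma bw_dist_eq_norm_iff:
  fixes X Y :: "real^'n^'n"
  shows "bw_dist (X ** transpose X) (Y ** transpose Y) = norm (X - Y) \<longleftrightarrow> transpose X ** Y \<in> Cov"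
proof
  assume eq: "bw_dist (X ** transpose X) (Y ** transpose Y) = norm (X - Y)"
  show "transpose X ** Y \<in> Cov"
  proof (rule Cov_if_trace_maximal)
    fix Q :: "real^'n^'n" assume Q: "orthogonal_matrix Q"
    have "norm (X - Y) \<le> norm (X - Y ** Q)"
      using bw_dist_le[OF gram_in_Cov gram_in_Cov refl mult_orthogonal_factor[OF Q]] eq by metis
    then show "trace (transpose X ** Y ** Q) \<le> trace (transpose X ** Y)"
      by (simp only: norm_diff_le_mult_orthogonal_iff[OF Q])
  qed
next
  assume H: "transpose X ** Y \<in> Cov"
  have "norm (X - Y) \<le> bw_dist (X ** transpose X) (Y ** transpose Y) + e" if e: "e > 0" for e
  proof -
    obtain Y' where Y': "Y' ** transpose Y' = Y ** transpose Y"
      "norm (X - Y') < bw_dist (X ** transpose X) (Y ** transpose Y) + e"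
      using bw_dist_approx[OF gram_in_Cov gram_in_Cov e refl] .
    obtain Q where Q: "orthogonal_matrix Q" "Y' = Y ** Q" using gram_mult_orthogonalE[OF Y'(1)] .
    have "norm (X - Y) \<le> norm (X - Y')"
      unfolding Q(2) norm_diff_le_mult_orthogonal_iff[OF Q(1)] by (rule Cov_trace_maximal[OF H Q(1)])
    then show ?thesis using Y'(2) by linarith
  qed
  then have "norm (X - Y) \<le> bw_dist (X ** transpose X) (Y ** transpose Y)"
    by (rule field_le_epsilon)
  then show "bw_dist (X ** transpose X) (Y ** transpose Y) = norm (X - Y)"
    using bw_dist_le[OF gram_in_Cov gram_in_Cov refl refl] by (metis order_antisym)
qed

text \<open>The fibre over \<open>B\<close> is compact: it is closed, and all its elements have norm \<open>sqrt (trace B)\<close>.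
  The nearest element can be found for any prescribed factor \<open>X\<close> of the first argument because the orthogonal group
  acts transitively on that fibre, by isometries.\<close>
lemma bw_dist_attained:
  fixes X :: "real^'n^'n"
  assumes B: "B \<in> Cov"
  obtains Y where "Y ** transpose Y = B" "norm (X - Y) = bw_dist (X ** transpose X) B"
proof -
  let ?F = "{Y :: real^'n^'n. Y ** transpose Y = B}"
  have "norm Y = sqrt (trace B)" if "Y \<in> ?F" for Y
    using that by (simp add: norm_eq_sqrt_inner inner_matrix_eq_trace trace_mul_sym[of "transpose Y"])
  then have "bounded ?F" unfolding bounded_iff by (intro exI[of _ "sqrt (trace B)"]) simp
  moreover have "closed ?F"
  proof (rule closed_Collect_eq)
    show "continuous_on UNIV (\<lambda>Y :: real^'n^'n. Y ** transpose Y)"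
      unfolding matrix_matrix_mult_def transpose_def
      by (simp, intro continuous_intros)
  qed (intro continuous_intros)
  ultimately have "compact ?F" by (simp add: compact_eq_bounded_closed)
  moreover have "?F \<noteq> {}" using Cov_factor[OF B] by blast
  moreover have "continuous_on ?F (\<lambda>Y. norm (X - Y))" by (intro continuous_intros)
  ultimately obtain Y where Y: "Y \<in> ?F" "\<And>Y'. Y' \<in> ?F \<Longrightarrow> norm (X - Y) \<le> norm (X - Y')"
    using continuous_attains_inf[of ?F "\<lambda>Y. norm (X - Y)"] by blast
  have "norm (X - Y) \<le> bw_dist (X ** transpose X) B + e" if e: "e > 0" for e
  proof -
    obtain Y' where "Y' ** transpose Y' = B"
      and "norm (X - Y') < bw_dist (X ** transpose X) B + e"
      using bw_dist_approx[OF gram_in_Cov B e refl] .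
    then show ?thesis using Y(2)[of Y'] by simp
  qed
  then have "norm (X - Y) \<le> bw_dist (X ** transpose X) B" by (rule field_le_epsilon)
  then have "norm (X - Y) = bw_dist (X ** transpose X) B"
    using bw_dist_le[OF gram_in_Cov B refl, of Y X] Y(1) by (simp add: order_antisym)
  then show thesis using that Y(1) by blast
qed

section \<open>Segments between aligned factors\<close>

lemma point_on_segment_if_dist_split:
  fixes x y z :: "'a :: real_inner"
  assumes "norm (x - z) = t * D" "norm (z - y) = (1 - t) * D" "norm (x - y) = D"
  shows "z = (1 - t) *\<^sub>R x + t *\<^sub>R y"
proof -
  let ?m = "(1 - t) *\<^sub>R x + t *\<^sub>R y"
  have "(norm (z - ?m))\<^sup>2
      = (1 - t) * (norm (x - z))\<^sup>2 + t * (norm (z - y))\<^sup>2 - t * (1 - t) * (norm (x - y))\<^sup>2"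
    unfolding power2_norm_eq_inner
    by (simp add: inner_add_left inner_add_right inner_diff_left inner_diff_right
        inner_commute[of y x] inner_commute[of z x] inner_commute[of z y] power2_eq_square
        algebra_simps)
  also have "\<dots> = 0" unfolding assms by (simp add: power2_eq_square algebra_simps)
  finally show ?thesis by simp
qed

text \<open>\<open>W\<close> is a lift of \<open>B\<close> nearest to \<open>Z\<close>, and \<open>Y\<close> a lift of \<open>C\<close> nearest to \<open>W\<close>. As \<open>B\<close> lies between
  \<open>Z ** transpose Z\<close> and \<open>C\<close>, no length is lost in going from \<open>Z\<close> to \<open>Y\<close> through \<open>W\<close>; hence \<open>Y\<close> is also nearest to \<open>Z\<close>,
  and \<open>W\<close> lies on the straight segment.\<close>
lemma lift_of_metric_segment:
  fixes Z :: "real^'n^'n"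
  assumes "B \<in> Cov" "C \<in> Cov" "0 \<le> t" "t \<le> 1"
    and AB: "bw_dist (Z ** transpose Z) B = t * bw_dist (Z ** transpose Z) C"
    and BC: "bw_dist B C = (1 - t) * bw_dist (Z ** transpose Z) C"
  obtains Y W where "Y ** transpose Y = C" "transpose Z ** Y \<in> Cov"
    "W = (1 - t) *\<^sub>R Z + t *\<^sub>R Y" "W ** transpose W = B"
proof -
  define D where "D = bw_dist (Z ** transpose Z) C"
  obtain W where W: "W ** transpose W = B" "norm (Z - W) = t * D"
    using bw_dist_attained[OF assms(1), of Z] AB D_def by metis
  obtain Y where Y: "Y ** transpose Y = C" "norm (W - Y) = (1 - t) * D"
    using bw_dist_attained[OF assms(2), of W] BC D_def W(1) by metis
  have "D \<le> norm (Z - Y)"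
    unfolding D_def using bw_dist_le[OF gram_in_Cov assms(2) refl Y(1)] .
  moreover have "norm (Z - Y) \<le> t * D + (1 - t) * D"
    using norm_triangle_ineq[of "Z - W" "W - Y"] W(2) Y(2) by simp
  ultimately have ZY: "norm (Z - Y) = D" by (simp add: algebra_simps)
  have "transpose Z ** Y \<in> Cov"
    using bw_dist_eq_norm_iff[of Z Y] ZY Y(1) D_def by metis
  moreover have "W = (1 - t) *\<^sub>R Z + t *\<^sub>R Y"
    by (rule point_on_segment_if_dist_split[OF W(2) Y(2) ZY])
  ultimately show thesis using that W(1) Y(1) by blast
qed

text \<open>Write \<open>Y' = Y ** Q\<close>. Both \<open>transpose Z ** Y\<close> and \<open>transpose Z ** Y'\<close> are positive semi-definite
  square roots of the same matrix, so \<open>transpose Z ** Y ** (Q - mat 1) = 0\<close>. Now \<open>transpose Z ** Y\<close>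
  is the sum of a positive semi-definite matrix and \<open>t *\<^sub>R (transpose Y ** Y)\<close>, so \<open>t > 0\<close> forces
  \<open>Y ** (Q - mat 1) = 0\<close>.\<close>
lemma aligned_extension_unique:
  fixes X Y Y' :: "real^'n^'n"
  assumes H: "transpose X ** Y \<in> Cov" and t: "0 < t" "t \<le> 1"
    and Z: "Z = (1 - t) *\<^sub>R X + t *\<^sub>R Y"
    and Y': "Y' ** transpose Y' = Y ** transpose Y" "transpose Z ** Y' \<in> Cov"
  shows "Y' = Y"
proof -
  have ZY: "transpose Z ** Y = (1 - t) *\<^sub>R (transpose X ** Y) + t *\<^sub>R (transpose Y ** Y)"
    by (simp add: Z matrix_ring_simps)
  have gram: "transpose Y ** Y \<in> Cov" using gram_in_Cov[of "transpose Y"] by simp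
  have ZYCov: "transpose Z ** Y \<in> Cov"
    unfolding ZY using H gram t
    by (auto simp: Cov_def transpose_add transpose_scalar matrix_vector_mult_add_rdistrib
        scaleR_matrix_vector_assoc[symmetric] inner_add_right)
  have sq: "(transpose Z ** V) ** (transpose Z ** V) = transpose Z ** (Y ** transpose Y) ** Z"
    if "V ** transpose V = Y ** transpose Y" "transpose Z ** V \<in> Cov" for V
  proof -
    have "(transpose Z ** V) ** (transpose Z ** V)
        = (transpose Z ** V) ** transpose (transpose Z ** V)"
      using Cov_transpose[OF that(2)] by simp
    also have "\<dots> = transpose Z ** (V ** transpose V) ** Z"
      by (simp add: matrix_transpose_mul matrix_mul_assoc)
    finally show ?thesis using that(1) by simp
  qed
  have same: "transpose Z ** Y' = transpose Z ** Y"
    by (rule Cov_square_inject[OF Y'(2) ZYCov]) (metis sq Y' ZYCov)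
  obtain Q where Q: "orthogonal_matrix Q" "Y' = Y ** Q" using gram_mult_orthogonalE[OF Y'(1)] .
  define W where "W = Q - mat 1"
  have "transpose Z ** Y ** W = 0"
    using same by (simp add: W_def Q(2) matrix_diff_ldistrib matrix_mul_assoc)
  then have "W \<bullet> (transpose Z ** Y ** W) = 0" by simp
  then have "(1 - t) * (W \<bullet> (transpose X ** Y ** W)) + t * (W \<bullet> (transpose Y ** Y ** W)) = 0"
    by (simp only: ZY matrix_ring_simps inner_add_right inner_scaleR_right)
  moreover have "0 \<le> (1 - t) * (W \<bullet> (transpose X ** Y ** W))"
    using Cov_inner_ge_0[OF H] t by simp
  moreover have "W \<bullet> (transpose Y ** Y ** W) = (Y ** W) \<bullet> (Y ** W)"
    by (simp add: inner_matrix_mult_left matrix_mul_assoc)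
  ultimately have "t * ((Y ** W) \<bullet> (Y ** W)) \<le> 0" by simp
  then have "(Y ** W) \<bullet> (Y ** W) = 0"
    using t inner_ge_zero[of "Y ** W"] by (simp add: mult_le_0_iff)
  then have "Y ** W = 0" by simp
  then show ?thesis by (simp add: W_def Q(2) matrix_diff_ldistrib)
qed

text \<open>The three parts of the segment are at least as long as the distances that they bound, while the whole
  realises the distance of its end fibres; so all three bounds are attained.\<close>
lemma aligned_segment_dist:
  fixes X Y :: "real^'n^'n"
  assumes H: "transpose X ** Y \<in> Cov" and st: "0 \<le> s" "s \<le> t" "t \<le> 1"
  defines "Z \<equiv> \<lambda>r. (1 - r) *\<^sub>R X + r *\<^sub>R Y"
  shows "bw_dist (Z s ** transpose (Z s)) (Z t ** transpose (Z t)) = (t - s) * norm (X - Y)"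
proof -
  let ?d = "\<lambda>r r'. bw_dist (Z r ** transpose (Z r)) (Z r' ** transpose (Z r'))"
  have le: "?d a b \<le> (b - a) * norm (X - Y)" if "a \<le> b" for a b
  proof -
    have "Z a - Z b = (b - a) *\<^sub>R (X - Y)" by (simp add: Z_def algebra_simps)
    then have "norm (Z a - Z b) = (b - a) * norm (X - Y)" using that by simp
    then show ?thesis using bw_dist_le[OF gram_in_Cov gram_in_Cov refl refl, of "Z a" "Z b"] by simp
  qed
  have "norm (X - Y) = ?d 0 1" using H[folded bw_dist_eq_norm_iff] by (simp add: Z_def)
  also have "\<dots> \<le> ?d 0 s + ?d s t + ?d t 1"
    using BW.triangle[OF gram_in_Cov[of "Z 0"] gram_in_Cov[of "Z s"] gram_in_Cov[of "Z 1"]]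
      BW.triangle[OF gram_in_Cov[of "Z s"] gram_in_Cov[of "Z t"] gram_in_Cov[of "Z 1"]] by linarith
  finally have "norm (X - Y) \<le> s * norm (X - Y) + ?d s t + (1 - t) * norm (X - Y)"
    using le[of 0 s] le[of t 1] st by simp
  then have "(t - s) * norm (X - Y) \<le> ?d s t" by (simp add: algebra_simps)
  then show ?thesis using le[OF st(2)] by simp
qed

text \<open>The midpoint serves as the base point because from an interior point the lifts of both endpoints
  are unique, whereas from \<open>X\<close> the lift of \<open>\<gamma> 1\<close> may depend on a choice.\<close>
lemma bw_geodesic_lift:
  fixes X :: "real^'n^'n"
  assumes cov: "\<gamma> ` {0..1} \<subseteq> Cov"
    and lin: "\<And>s t. 0 \<le> s \<Longrightarrow> s \<le> t \<Longrightarrow> t \<le> 1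
        \<Longrightarrow> bw_dist (\<gamma> s) (\<gamma> t) = bw_dist (\<gamma> 0) (\<gamma> 1) * (t - s)"
    and X: "X ** transpose X = \<gamma> 0"
  obtains Y where "Y ** transpose Y = \<gamma> 1" "transpose X ** Y \<in> Cov"
    "\<And>t. t \<in> {0..1} \<Longrightarrow> \<gamma> t = ((1 - t) *\<^sub>R X + t *\<^sub>R Y) ** transpose ((1 - t) *\<^sub>R X + t *\<^sub>R Y)"
proof -
  have \<gamma>: "\<gamma> t \<in> Cov" if "0 \<le> t" "t \<le> 1" for t using cov that by auto
  define D where "D = bw_dist (\<gamma> 0) (\<gamma> 1)"
  have fwd: "bw_dist (\<gamma> s) (\<gamma> t) = D * (t - s)" if "0 \<le> s" "s \<le> t" "t \<le> 1" for s t
    unfolding D_def using that by (rule lin)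
  have bwd: "bw_dist (\<gamma> t) (\<gamma> s) = D * (t - s)" if "0 \<le> s" "s \<le> t" "t \<le> 1" for s t
    using fwd[OF that] bw_dist_commute[of "\<gamma> t" "\<gamma> s"] by simp
  have mid: "bw_dist (X ** transpose X) (\<gamma> (1/2)) = (1/2) * bw_dist (X ** transpose X) (\<gamma> 1)"
    "bw_dist (\<gamma> (1/2)) (\<gamma> 1) = (1 - 1/2) * bw_dist (X ** transpose X) (\<gamma> 1)"
    unfolding X by (simp_all add: fwd)
  obtain Y Z where Y: "Y ** transpose Y = \<gamma> 1" "transpose X ** Y \<in> Cov"
    and Z: "Z = (1 - 1/2) *\<^sub>R X + (1/2) *\<^sub>R Y" "Z ** transpose Z = \<gamma> (1/2)"
    by (rule lift_of_metric_segment[OF \<gamma> \<gamma> _ _ mid]) auto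
  have YX: "transpose Y ** X \<in> Cov"
    using Y(2) Cov_transpose[OF Y(2)] by (simp add: matrix_transpose_mul)
  have "\<gamma> t = ((1 - t) *\<^sub>R X + t *\<^sub>R Y) ** transpose ((1 - t) *\<^sub>R X + t *\<^sub>R Y)"
    if t: "t \<in> {0..1}" for t
  proof (cases "t \<le> 1/2")
    case True
    \<comment> \<open>\<open>1 - 2 * t\<close> is the position of \<open>\<gamma> t\<close> on the half of the geodesic that runs back from the midpoint.\<close>
    have split: "bw_dist (Z ** transpose Z) (\<gamma> t) = (1 - 2 * t) * bw_dist (Z ** transpose Z) (\<gamma> 0)"
      "bw_dist (\<gamma> t) (\<gamma> 0) = (1 - (1 - 2 * t)) * bw_dist (Z ** transpose Z) (\<gamma> 0)"
      unfolding Z(2) using bwd[of t "1/2"] bwd[of 0 t] bwd[of 0 "1/2"] True t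
      by (simp_all add: algebra_simps)
    obtain X' W where X': "X' ** transpose X' = \<gamma> 0" "transpose Z ** X' \<in> Cov"
      and W: "W = (1 - (1 - 2 * t)) *\<^sub>R Z + (1 - 2 * t) *\<^sub>R X'" "W ** transpose W = \<gamma> t"
      by (rule lift_of_metric_segment[OF \<gamma> \<gamma> _ _ split]) (use True t in auto)
    have "X' = X"
      by (rule aligned_extension_unique[OF YX, of "1/2" Z])
        (use X X' Z(1) in \<open>simp_all add: add.commute\<close>)
    have "W = (1 - t) *\<^sub>R X + t *\<^sub>R Y"
      unfolding W(1) Z(1) \<open>X' = X\<close> by (simp add: vec_eq_iff field_simps)
    then show ?thesis using W(2) by simp
  next
    case False
    have split: "bw_dist (Z ** transpose Z) (\<gamma> t) = (2 * t - 1) * bw_dist (Z ** transpose Z) (\<gamma> 1)"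
      "bw_dist (\<gamma> t) (\<gamma> 1) = (1 - (2 * t - 1)) * bw_dist (Z ** transpose Z) (\<gamma> 1)"
      unfolding Z(2) using fwd[of "1/2" t] fwd[of t 1] fwd[of "1/2" 1] False t
      by (simp_all add: algebra_simps)
    obtain Y' W where Y': "Y' ** transpose Y' = \<gamma> 1" "transpose Z ** Y' \<in> Cov"
      and W: "W = (1 - (2 * t - 1)) *\<^sub>R Z + (2 * t - 1) *\<^sub>R Y'" "W ** transpose W = \<gamma> t"
      by (rule lift_of_metric_segment[OF \<gamma> \<gamma> _ _ split]) (use False t in auto)
    have "Y' = Y"
      by (rule aligned_extension_unique[OF Y(2), of "1/2" Z]) (use Y Y' Z(1) in simp_all)
    have "W = (1 - t) *\<^sub>R X + t *\<^sub>R Y"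
      unfolding W(1) Z(1) \<open>Y' = Y\<close> by (simp add: vec_eq_iff field_simps)
    then show ?thesis using W(2) by simp
  qed
  then show thesis using that Y by blast
qed

section \<open>Rank along an aligned segment\<close>

text \<open>\<open>B\<close> factors linearly through the range of \<open>A\<close>.\<close>
lemma rank_le_if_kernel_subset:
  fixes A :: "real^'n^'m" and B :: "real^'n^'k"
  assumes "\<And>v. A *v v = 0 \<Longrightarrow> B *v v = 0"
  shows "rank B \<le> rank A"
proof -
  have linA: "linear ((*v) A)" and linB: "linear ((*v) B)" by (rule matrix_vector_mul_linear)+
  obtain h where h: "linear h" "\<And>w. w \<in> range ((*v) A) \<Longrightarrow> A *v (h w) = w"
    using real_vector.linear_exists_right_inverse_on[OF linA subspace_UNIV] by auto
  have "B *v v = B *v (h (A *v v))" for v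
  proof -
    have "A *v (h (A *v v) - v) = 0" by (simp add: h(2) matrix_vector_mult_diff_distrib)
    then have "B *v (h (A *v v) - v) = 0" by (rule assms)
    then show ?thesis by (simp add: matrix_vector_mult_diff_distrib)
  qed
  then have "range ((*v) B) = ((*v) B \<circ> h) ` range ((*v) A)" by (auto simp: image_image)
  moreover have "linear ((*v) B \<circ> h)" by (rule linear_compose[OF h(1) linB])
  ultimately show ?thesis unfolding rank_dim_range by (metis dim_image_le)
qed

lemma rank_gram: "rank (Z ** transpose Z) = rank (Z :: real^'n^'m)"
proof -
  have "transpose Z *v v = 0" if "(Z ** transpose Z) *v v = 0" for v
  proof -
    have "(transpose Z *v v) \<bullet> (transpose Z *v v) = 0"
      unfolding inner_matrix_vector_left transpose_transpose matrix_vector_mul_assoc that by simp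
    then show ?thesis by simp
  qed
  then have "rank (transpose Z) \<le> rank (Z ** transpose Z)" by (rule rank_le_if_kernel_subset)
  then show ?thesis using rank_mul_le_left[of Z "transpose Z"] by (simp add: rank_transpose)
qed

text \<open>If \<open>(1 - t) *\<^sub>R (X *v v) = - t *\<^sub>R (Y *v v)\<close>, then pairing with \<open>X *v v\<close> contradicts
  \<open>0 \<le> (X *v v) \<bullet> (Y *v v)\<close> unless \<open>X *v v = 0\<close>.\<close>
lemma aligned_segment_kernel:
  fixes X Y :: "real^'n^'n"
  assumes H: "transpose X ** Y \<in> Cov" and t: "0 < t" "t < 1"
  shows "((1 - t) *\<^sub>R X + t *\<^sub>R Y) *v v = 0 \<longleftrightarrow> X *v v = 0 \<and> Y *v v = 0"
proof
  assume "((1 - t) *\<^sub>R X + t *\<^sub>R Y) *v v = 0"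
  then have sum: "(1 - t) *\<^sub>R (X *v v) + t *\<^sub>R (Y *v v) = 0"
    by (simp add: matrix_vector_mult_add_rdistrib scaleR_matrix_vector_assoc)
  then have "(1 - t) * ((X *v v) \<bullet> (X *v v)) + t * ((X *v v) \<bullet> (Y *v v)) = 0"
    using arg_cong[of _ _ "\<lambda>w. (X *v v) \<bullet> w"]
    by (metis (no_types) inner_add_right inner_scaleR_right inner_zero_right)
  moreover have "0 \<le> (X *v v) \<bullet> (Y *v v)"
    using H unfolding inner_matrix_vector_left matrix_vector_mul_assoc Cov_def by blast
  then have "0 \<le> t * ((X *v v) \<bullet> (Y *v v))" using t by simp
  ultimately have "(1 - t) * ((X *v v) \<bullet> (X *v v)) \<le> 0" by linarith
  then have "(X *v v) \<bullet> (X *v v) = 0"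
    using t inner_ge_zero[of "X *v v"] by (simp add: mult_le_0_iff)
  then have "X *v v = 0" by simp
  then show "X *v v = 0 \<and> Y *v v = 0" using sum t by simp
qed (simp add: matrix_vector_mult_add_rdistrib scaleR_matrix_vector_assoc[symmetric])

lemma aligned_segment_rank:
  fixes X Y :: "real^'n^'n"
  assumes H: "transpose X ** Y \<in> Cov"
  shows "\<exists>p \<ge> max (rank X) (rank Y). \<forall>t\<in>{0<..<1}. rank ((1 - t) *\<^sub>R X + t *\<^sub>R Y) = p"
proof -
  define Z where "Z = (\<lambda>t. (1 - t) *\<^sub>R X + t *\<^sub>R Y)"
  have ker: "Z t *v v = 0 \<longleftrightarrow> X *v v = 0 \<and> Y *v v = 0" if "t \<in> {0<..<1}" for t v
    using aligned_segment_kernel[OF H] that by (simp add: Z_def)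
  have half: "(1/2 :: real) \<in> {0<..<1}" by simp
  have "rank (Z t) = rank (Z (1/2))" if "t \<in> {0<..<1}" for t
    by (rule order_antisym; rule rank_le_if_kernel_subset) (simp_all only: ker[OF that] ker[OF half])
  moreover have "rank X \<le> rank (Z (1/2))" "rank Y \<le> rank (Z (1/2))"
    by (rule rank_le_if_kernel_subset, simp only: ker[OF half])+
  ultimately show ?thesis unfolding Z_def by (intro exI[of _ "rank (Z (1/2))"]) (auto simp: Z_def)
qed

section \<open>Geodesics as projected segments\<close>

text \<open>The given curve is the projection of the segment from \<open>X\<close> to \<open>Y ** transpose R\<close>; the transpose
  of \<open>R\<close> matches the one in \<open>bw_H\<close>.\<close>
lemma bw_curve_eq_gram:
  fixes X Y R :: "real^'n^'n"
  defines "Y' \<equiv> Y ** transpose R"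
  assumes "orthogonal_matrix R"
  shows "bw_curve (X ** transpose X) (Y ** transpose Y) X Y R t
     = ((1 - t) *\<^sub>R X + t *\<^sub>R Y') ** transpose ((1 - t) *\<^sub>R X + t *\<^sub>R Y')"
proof -
  have gram: "Y ** transpose Y = Y' ** transpose Y'"
    using mult_orthogonal_factor[of "transpose R" Y] assms(2) by (simp add: Y'_def)
  have cross: "X ** R ** transpose Y = X ** transpose Y'"
    by (simp add: Y'_def matrix_transpose_mul matrix_mul_assoc)
  show ?thesis
    unfolding bw_curve_def sym_part_def gram cross matrix_ring_simps transpose_transpose
    by (simp add: vec_eq_iff power2_eq_square algebra_simps)
qed

theorem theorem6p2:
  fixes \<Sigma> \<Lambda> X Y :: "real^'n^'n" and \<gamma> :: "real \<Rightarrow> real^'n^'n" and k l :: nat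
  assumes "\<Sigma> \<in> Cov" and "\<Lambda> \<in> Cov"
    and "rank \<Sigma> = k" and "rank \<Lambda> = l"
    and "X ** transpose X = \<Sigma>" and "Y ** transpose Y = \<Lambda>"
  shows "(BW.minimizing_geodesic_on {0..1} \<gamma> \<and> \<gamma> 0 = \<Sigma> \<and> \<gamma> 1 = \<Lambda> \<longleftrightarrow>
           (\<exists>R. orthogonal_matrix R \<and> bw_H X Y R \<in> Cov
                \<and> (\<forall>t\<in>{0..1}. \<gamma> t = bw_curve \<Sigma> \<Lambda> X Y R t)))
       \<and> (\<forall>R. orthogonal_matrix R \<and> bw_H X Y R \<in> Cov \<longrightarrow>
             bw_H X Y R = cov_sqrt (transpose X ** \<Lambda> ** X)
           \<and> (\<exists>p\<ge>max k l. \<forall>t\<in>{0<..<1}. rank (bw_curve \<Sigma> \<Lambda> X Y R t) = p))"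
    (is "(?geo \<longleftrightarrow> ?param) \<and> ?more")
proof (intro conjI iffI)
  have H: "bw_H X Y R = transpose X ** (Y ** transpose R)" for R
    by (simp add: bw_H_def matrix_mul_assoc)
  have curve: "bw_curve \<Sigma> \<Lambda> X Y R t
      = ((1 - t) *\<^sub>R X + t *\<^sub>R (Y ** transpose R))
        ** transpose ((1 - t) *\<^sub>R X + t *\<^sub>R (Y ** transpose R))"
    if "orthogonal_matrix R" for R t
    using bw_curve_eq_gram[OF that] assms(5,6) by metis
  have YR: "(Y ** transpose R) ** transpose (Y ** transpose R) = \<Lambda>" if "orthogonal_matrix R" for R
    using mult_orthogonal_factor[of "transpose R" Y] that assms(6) by simp
  show ?param if ?geo
  proof -
    have g: "BW.minimizing_geodesic_on {0..1} \<gamma>" and ends: "\<gamma> 0 = \<Sigma>" "\<gamma> 1 = \<Lambda>" using that by auto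
    have cov: "\<gamma> ` {0..1} \<subseteq> Cov"
      using g by (simp only: BW.minimizing_geodesic_on_unit_interval_iff)
    have lin: "bw_dist (\<gamma> s) (\<gamma> t) = bw_dist (\<gamma> 0) (\<gamma> 1) * (t - s)"
      if "0 \<le> s" "s \<le> t" "t \<le> 1" for s t
      using g that unfolding BW.minimizing_geodesic_on_unit_interval_iff
      by (metis atLeastAtMost_iff order_trans)
    have "X ** transpose X = \<gamma> 0" using assms(5) ends by simp
    from bw_geodesic_lift[OF cov lin this]
    obtain Y' where Y': "Y' ** transpose Y' = \<gamma> 1" "transpose X ** Y' \<in> Cov"
      "\<And>t. t \<in> {0..1} \<Longrightarrow>
        \<gamma> t = ((1 - t) *\<^sub>R X + t *\<^sub>R Y') ** transpose ((1 - t) *\<^sub>R X + t *\<^sub>R Y')"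
      by blast
    obtain Q where Q: "orthogonal_matrix Q" "Y' = Y ** Q"
      using gram_mult_orthogonalE[of Y' Y] Y'(1) assms(6) ends by metis
    then have "orthogonal_matrix (transpose Q)" "Y' = Y ** transpose (transpose Q)" by simp_all
    then show ?thesis using Y'(2,3) by (metis H curve)
  qed
  show "BW.minimizing_geodesic_on {0..1} \<gamma>" "\<gamma> 0 = \<Sigma>" "\<gamma> 1 = \<Lambda>" if param: ?param
  proof -
    obtain R where R: "orthogonal_matrix R" "transpose X ** (Y ** transpose R) \<in> Cov"
      "\<And>t. t \<in> {0..1} \<Longrightarrow> \<gamma> t = bw_curve \<Sigma> \<Lambda> X Y R t"
      using param unfolding H by blast
    have \<gamma>: "\<gamma> t = ((1 - t) *\<^sub>R X + t *\<^sub>R (Y ** transpose R))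
        ** transpose ((1 - t) *\<^sub>R X + t *\<^sub>R (Y ** transpose R))" if "t \<in> {0..1}" for t
      using R(3)[OF that] curve[OF R(1)] by simp
    have d: "bw_dist (\<gamma> s) (\<gamma> t) = (t - s) * norm (X - Y ** transpose R)"
      if "s \<in> {0..1}" "t \<in> {0..1}" "s \<le> t" for s t
      using aligned_segment_dist[OF R(2), of s t] that by (simp add: \<gamma>)
    have "\<gamma> ` {0..1} \<subseteq> Cov" using \<gamma> gram_in_Cov by force
    then show "BW.minimizing_geodesic_on {0..1} \<gamma>"
      unfolding BW.minimizing_geodesic_on_unit_interval_iff using d by simp
    show "\<gamma> 0 = \<Sigma>" "\<gamma> 1 = \<Lambda>" using \<gamma>[of 0] \<gamma>[of 1] assms(5) YR[OF R(1)] by simp_all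
  qed
  show ?more
  proof (intro allI impI conjI; elim conjE)
    fix R assume R: "orthogonal_matrix R" and HR: "bw_H X Y R \<in> Cov"
    have "bw_H X Y R ** bw_H X Y R = bw_H X Y R ** transpose (bw_H X Y R)"
      using Cov_transpose[OF HR] by simp
    also have "\<dots> = transpose X ** ((Y ** transpose R) ** transpose (Y ** transpose R)) ** X"
      unfolding H by (simp add: matrix_transpose_mul matrix_mul_assoc)
    finally show "bw_H X Y R = cov_sqrt (transpose X ** \<Lambda> ** X)"
      unfolding YR[OF R] using cov_sqrt_eqI[OF HR] by metis
    have "k = rank X" "l = rank (Y ** transpose R)"
      using assms(3-5) YR[OF R] rank_gram by metis+
    then show "\<exists>p\<ge>max k l. \<forall>t\<in>{0<..<1}. rank (bw_curve \<Sigma> \<Lambda> X Y R t) = p"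
      unfolding curve[OF R] rank_gram using aligned_segment_rank HR[unfolded H] by blast
  qed
qed

end
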